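(* Suppose that the acceleration of a motion of a point $P$ in the plane is centripetal (directed towards a fixed center $O$) and inversely proportional to the square of $\overline{OP}=r$, namely for some constant $C>0$, $$\overrightarrow{a}=\frac{C}{r^{2}}\binom{-\cos\theta}{-\sin\theta}.$$ Then the motion satisfies the area law, and its orbit is a conic section with the center $O$ as one of its foci.
   Context: $(r,\theta)$ are polar coordinates of the moving point $P$ centered at $O$, so $\overrightarrow{OP}=r\binom{\cos\theta}{\sin\theta}$ with $r$, $\theta$ functions of time $t$, and $\overrightarrow{a}=\frac{d^{2}}{dt^{2}}\overrightarrow{OP}$ is the acceleration vector. The area law says that the area $\frac{dA}{dt}$ swept out by $\overrightarrow{OP}$ per unit time is constant, where $2\frac{dA}{dt}=r^{2}\dot{\theta}$ and $\dot\theta=\frac{d\theta}{dt}$. The orbit is the trajectory curve of $P$. "Conic section" has its usual meaning, a circle being counted as an ellipse whose two foci coincide with its center.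
   Formalization: A radial motion (zero areal velocity) has a straight orbit, not a conic; there the orbit is only shown to lie on a ray from O. Otherwise the orbit lies on a conic with focus O, and a motion defined for all times traces the whole ellipse or parabola, or one branch of the hyperbola. *)

theory Defs
  imports "HOL-Analysis.Analysis"
begin

text \<open>Rate \<open>dA/dt\<close> at which the radius vector with polar coordinates \<open>(r, \<theta>)\<close> sweeps out area.\<close>

definition areal_velocity :: "(real \<Rightarrow> real) \<Rightarrow> (real \<Rightarrow> real) \<Rightarrow> real \<Rightarrow> real" where
  "areal_velocity r \<theta> t = (r t)\<^sup>2 * deriv \<theta> t / 2"

text \<open>In the three predicates below the first argument is a focus. Degenerate curves are excluded;
  a circle is an ellipse with \<open>G = F\<close>, and a hyperbola consists of both of its branches.\<close>

definition ellipse_with_focus :: "real^2 \<Rightarrow> (real^2) set \<Rightarrow> bool" where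
  "ellipse_with_focus F K \<longleftrightarrow>
     (\<exists>G a. dist F G < 2 * a \<and> K = {X. dist X F + dist X G = 2 * a})"

definition hyperbola_with_focus :: "real^2 \<Rightarrow> (real^2) set \<Rightarrow> bool" where
  "hyperbola_with_focus F K \<longleftrightarrow>
     (\<exists>G a. 0 < a \<and> 2 * a < dist F G \<and> K = {X. \<bar>dist X F - dist X G\<bar> = 2 * a})"

definition parabola_with_focus :: "real^2 \<Rightarrow> (real^2) set \<Rightarrow> bool" where
  "parabola_with_focus F K \<longleftrightarrow>
     (\<exists>L. affine L \<and> aff_dim L = 1 \<and> F \<notin> L \<and> K = {X. dist X F = infdist X L})"

definition conic_section_with_focus :: "real^2 \<Rightarrow> (real^2) set \<Rightarrow> bool" where
  "conic_section_with_focus F K \<longleftrightarrow>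
     ellipse_with_focus F K \<or> parabola_with_focus F K \<or> hyperbola_with_focus F K"

end

theory Submission
  imports Defs
begin

text \<open>Write \<open>U \<phi>\<close> for the unit vector at angle \<open>\<phi>\<close>. Conservation of \<open>h = r\<^sup>2 \<theta>'\<close> and of the
  Laplace-Runge-Lenz vector \<open>e\<close> gives the polar equation \<open>r (1 + e \<bullet> U \<theta>) = h\<^sup>2 / C\<close>. Its solution
  set \<open>B\<close> is an ellipse, a parabola or the near branch of a hyperbola according to whether
  \<open>norm e\<close> is less than, equal to or greater than 1.

  A motion defined for all times has \<open>h \<noteq> 0\<close>, since otherwise \<open>r\<close> would be a positive strictly
  concave function on the line. It runs through all of \<open>B\<close>: the angles with \<open>1 + e \<bullet> U \<phi> > 0\<close> form,
  up to full turns, one arc, and on a compact part of it \<open>r\<close> is bounded, so \<open>\<theta>' = h / r\<^sup>2\<close> stays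
  away from 0 and \<open>\<theta>\<close> passes through. As \<open>B\<close> is closed and separated from the far branch, it is a
  component of the conic.\<close>

section \<open>Conserved quantities of the motion and its polar equation\<close>

text \<open>In Cartesian coordinates relative to the center, \<open>h\<close> is the angular
  momentum \<open>x * w - y * v\<close>; it is constant because the acceleration is parallel to the
  position. Since \<theta>' = h / r^2, multiplying the acceleration by \<open>h / C\<close> gives,
  up to sign, \<theta>' times the radial unit vector, which integrates at once to the constants
  \<open>e1\<close> and \<open>e2\<close>. Projecting \<open>(e1, e2)\<close> onto the radial
  direction yields the polar equation.\<close>

lemma areal_integral_and_polar_equation:
  fixes x y v w r \<theta> :: "real \<Rightarrow> real"
  assumes "open T" and "convex T" and C: "C > 0"
    and r: "\<And>t. t \<in> T \<Longrightarrow> r t > 0"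
    and x: "\<And>t. t \<in> T \<Longrightarrow> x t = r t * cos (\<theta> t)"
    and y: "\<And>t. t \<in> T \<Longrightarrow> y t = r t * sin (\<theta> t)"
    and \<theta>: "\<And>t. t \<in> T \<Longrightarrow> \<theta> differentiable (at t)"
    and dx: "\<And>t. t \<in> T \<Longrightarrow> (x has_real_derivative v t) (at t)"
    and dy: "\<And>t. t \<in> T \<Longrightarrow> (y has_real_derivative w t) (at t)"
    and dv: "\<And>t. t \<in> T \<Longrightarrow> (v has_real_derivative - (C / (r t)\<^sup>2 * cos (\<theta> t))) (at t)"
    and dw: "\<And>t. t \<in> T \<Longrightarrow> (w has_real_derivative - (C / (r t)\<^sup>2 * sin (\<theta> t))) (at t)"
  obtains h e1 e2 where
    "\<And>t. t \<in> T \<Longrightarrow> (\<theta> has_real_derivative h / (r t)\<^sup>2) (at t)"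
    "\<And>t. t \<in> T \<Longrightarrow> r t * (1 + (e1 * cos (\<theta> t) + e2 * sin (\<theta> t))) = h\<^sup>2 / C"
proof -
  have const: "\<exists>c. \<forall>t\<in>T. f t = c"
    if "\<And>t. t \<in> T \<Longrightarrow> (f has_real_derivative 0) (at t)" for f :: "real \<Rightarrow> real"
    using has_field_derivative_zero_constant[OF \<open>convex T\<close>, of f] that
    by (metis has_field_derivative_at_within)
  have "\<exists>h. \<forall>t\<in>T. x t * w t - y t * v t = h"
  proof (rule const)
    fix t assume t: "t \<in> T"
    show "((\<lambda>t. x t * w t - y t * v t) has_real_derivative 0) (at t)"
      by (rule derivative_eq_intros dx[OF t] dy[OF t] dv[OF t] dw[OF t] refl)+
        (simp add: x[OF t] y[OF t])
  qed
  then obtain h where h: "\<And>t. t \<in> T \<Longrightarrow> x t * w t - y t * v t = h" by blast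
  \<comment> \<open>Differentiating the identity
    \<open>x * sin \<theta> - y * cos \<theta> = 0\<close> expresses the derivative of \<theta>
    through the velocity without differentiating \<open>r\<close>.\<close>
  have radial: "(\<theta> has_real_derivative (w t * cos (\<theta> t) - v t * sin (\<theta> t)) / r t) (at t)"
    if t: "t \<in> T" for t
  proof -
    obtain d where d: "(\<theta> has_real_derivative d) (at t)"
      using \<theta>[OF t] real_differentiable_def by blast
    have "((\<lambda>t. x t * sin (\<theta> t) - y t * cos (\<theta> t)) has_real_derivative
        v t * sin (\<theta> t) + r t * cos (\<theta> t) * (cos (\<theta> t) * d)
        - (w t * cos (\<theta> t) - r t * sin (\<theta> t) * (sin (\<theta> t) * d))) (at t)"
      by (rule derivative_eq_intros dx[OF t] dy[OF t] d refl)+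
        (simp add: x[OF t] y[OF t] algebra_simps)
    moreover have "((\<lambda>t. x t * sin (\<theta> t) - y t * cos (\<theta> t)) has_real_derivative 0) (at t)"
      by (rule has_field_derivative_transform_within_open[OF DERIV_const[of 0] \<open>open T\<close> t])
        (simp add: x y)
    ultimately have "v t * sin (\<theta> t) + r t * cos (\<theta> t) * (cos (\<theta> t) * d)
        - (w t * cos (\<theta> t) - r t * sin (\<theta> t) * (sin (\<theta> t) * d)) = 0"
      by (rule DERIV_unique)
    then have "w t * cos (\<theta> t) - v t * sin (\<theta> t)
        = r t * d * ((cos (\<theta> t))\<^sup>2 + (sin (\<theta> t))\<^sup>2)"
      by algebra
    then have "(w t * cos (\<theta> t) - v t * sin (\<theta> t)) / r t = d"
      using r[OF t] by simp
    with d show ?thesis by simp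
  qed
  have h': "w t * cos (\<theta> t) - v t * sin (\<theta> t) = h / r t" if t: "t \<in> T" for t
    using h[OF t] r[OF t] by (simp add: x[OF t] y[OF t] field_simps)
  have d\<theta>: "(\<theta> has_real_derivative h / (r t)\<^sup>2) (at t)" if t: "t \<in> T" for t
    using radial[OF t] unfolding h'[OF t] by (simp add: power2_eq_square)
  \<comment> \<open>The two components of the Laplace--Runge--Lenz vector.\<close>
  have "\<exists>e1. \<forall>t\<in>T. h / C * w t - cos (\<theta> t) = e1"
  proof (rule const)
    fix t assume t: "t \<in> T"
    show "((\<lambda>t. h / C * w t - cos (\<theta> t)) has_real_derivative 0) (at t)"
      by (rule derivative_eq_intros dw[OF t] d\<theta>[OF t] refl)+ (use C in simp)
  qed
  then obtain e1 where e1: "\<And>t. t \<in> T \<Longrightarrow> h / C * w t - cos (\<theta> t) = e1" by blast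
  have "\<exists>e2. \<forall>t\<in>T. - (h / C * v t) - sin (\<theta> t) = e2"
  proof (rule const)
    fix t assume t: "t \<in> T"
    show "((\<lambda>t. - (h / C * v t) - sin (\<theta> t)) has_real_derivative 0) (at t)"
      by (rule derivative_eq_intros dv[OF t] d\<theta>[OF t] refl)+ (use C in simp)
  qed
  then obtain e2 where e2: "\<And>t. t \<in> T \<Longrightarrow> - (h / C * v t) - sin (\<theta> t) = e2" by blast
  have "r t * (1 + (e1 * cos (\<theta> t) + e2 * sin (\<theta> t))) = h\<^sup>2 / C" if t: "t \<in> T" for t
  proof -
    have "e1 * cos (\<theta> t) + e2 * sin (\<theta> t)
        = h / C * (w t * cos (\<theta> t) - v t * sin (\<theta> t)) - ((cos (\<theta> t))\<^sup>2 + (sin (\<theta> t))\<^sup>2)"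
      unfolding e1[OF t, symmetric] e2[OF t, symmetric]
      by (simp add: algebra_simps power2_eq_square)
    also have "\<dots> = h\<^sup>2 / (C * r t) - 1"
      unfolding h'[OF t] by (simp add: power2_eq_square)
    finally show ?thesis using r[OF t] C by (simp add: field_simps)
  qed
  with d\<theta> show ?thesis by (rule that)
qed

section \<open>Real functions on the whole line\<close>

text \<open>A concave function lies below each of its tangents. As \<open>g\<close> is strictly
  decreasing, some tangent has nonzero slope, and where this tangent crosses zero \<open>f\<close>
  cannot be positive.\<close>

lemma not_strictly_concave_positive:
  fixes f g :: "real \<Rightarrow> real"
  assumes f: "\<And>t. (f has_real_derivative g t) (at t)"
    and g: "\<And>t. \<exists>d<0. (g has_real_derivative d) (at t)"
    and pos: "\<And>t. f t > 0"
  shows False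
proof -
  have dec: "g b < g a" if "a < b" for a b
    using DERIV_neg_imp_decreasing[OF that] g by blast
  have tangent: "f b \<le> f a + g a * (b - a)" for a b
  proof (cases a b rule: linorder_cases)
    case less
    then obtain z where "a < z" "f b - f a = (b - a) * g z"
      using MVT2[of a b f g] f by blast
    with dec[of a z] less mult_left_mono[of "g z" "g a" "b - a"] show ?thesis
      by (simp add: algebra_simps)
  next
    case greater
    then obtain z where "z < a" "f a - f b = (a - b) * g z"
      using MVT2[of b a f g] f by blast
    with dec[of z a] greater mult_left_mono[of "g a" "g z" "a - b"] show ?thesis
      by (simp add: algebra_simps)
  qed simp
  obtain a where a: "g a \<noteq> 0"
    using dec[of 0 1] by (metis less_irrefl zero_less_one)
  have "f (a - f a / g a) \<le> 0"
    using tangent[of "a - f a / g a" a] a by simp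
  with pos[of "a - f a / g a"] show False by linarith
qed

text \<open>If \<open>b\<close> were missed, \<open>f\<close> would stay between \<open>f a\<close>
  and \<open>b\<close> from time \<open>a\<close> on, hence grow at rate at least \<open>k\<close>,
  and would have arrived by time \<open>a + (b - f a) / k\<close>. The rate is bounded below only on
  this range of values because an orbit may be unbounded.\<close>

lemma increasing_reaches:
  fixes f f' :: "real \<Rightarrow> real"
  assumes f: "\<And>t. (f has_real_derivative f' t) (at t)" and nn: "\<And>t. f' t \<ge> 0"
    and k: "k > 0" and speed: "\<And>t. f a \<le> f t \<Longrightarrow> f t \<le> b \<Longrightarrow> f' t \<ge> k"
    and ab: "f a \<le> b"
  shows "b \<in> range f"
proof (rule ccontr)
  assume b: "b \<notin> range f"
  have cont: "continuous_on S f" for S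
    by (meson DERIV_isCont continuous_at_imp_continuous_on f)
  have below: "f s < b" if "a \<le> s" for s
  proof (rule ccontr)
    assume "\<not> f s < b"
    then show False using IVT'[of f a b s] ab that cont b by (force simp: not_less)
  qed
  have mono: "f a \<le> f s" if "a \<le> s" for s
    using DERIV_nonneg_imp_nondecreasing[OF that] f nn by blast
  define s where "s = a + (b - f a) / k"
  have "a < s" using below[of a] k by (simp add: s_def)
  then obtain z where z: "a < z" "f s - f a = (s - a) * f' z"
    using MVT2[of a s f f'] f by blast
  have "f' z \<ge> k" using speed mono[of z] below[of z] z(1) by simp
  then have "(s - a) * f' z \<ge> (s - a) * k" using \<open>a < s\<close> by simp
  then have "f s \<ge> b" using z(2) k by (simp add: s_def)
  with below[of s] \<open>a < s\<close> show False by simp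
qed

lemma monotone_reaches:
  fixes f g :: "real \<Rightarrow> real"
  assumes f: "\<And>t. (f has_real_derivative h * g t) (at t)" and "h \<noteq> 0" and g: "\<And>t. g t \<ge> 0"
    and k: "k > 0" and speed: "\<And>t. f t \<in> closed_segment (f a) b \<Longrightarrow> g t \<ge> k"
  shows "b \<in> range f"
proof -
  have sp: "\<bar>h\<bar> * g t \<ge> \<bar>h\<bar> * k" if "f t \<in> closed_segment (f a) b" for t
    using speed[OF that] by (simp add: mult_left_mono)
  have k': "\<bar>h\<bar> * k > 0" using k \<open>h \<noteq> 0\<close> by simp
  \<comment> \<open>Reduction to the increasing case: \<sigma> reflects values so that the target
    lies above the start, and \<tau> reverses time where necessary so that the derivative becomes
    \<open>\<bar>h\<bar> * g\<close>. Time runs over the whole line, so both directions are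
    available.\<close>
  define \<sigma> where "\<sigma> = (if f a \<le> b then 1 else - 1 :: real)"
  define \<tau> where "\<tau> = \<sigma> * sgn h"
  have s2: "\<tau> * \<tau> = 1" "\<sigma> * \<sigma> = 1" "\<sigma> * \<tau> * h = \<bar>h\<bar>"
    using \<open>h \<noteq> 0\<close> by (auto simp: \<sigma>_def \<tau>_def sgn_if)
  have d: "((\<lambda>t. \<sigma> * f (\<tau> * t)) has_real_derivative \<bar>h\<bar> * g (\<tau> * t)) (at t)" for t
  proof -
    have "((\<lambda>t. f (\<tau> * t)) has_real_derivative (h * g (\<tau> * t)) * \<tau>) (at t)"
      by (rule DERIV_chain2[OF f]) (auto intro!: derivative_eq_intros)
    moreover have "\<sigma> * (h * g (\<tau> * t) * \<tau>) = \<sigma> * \<tau> * h * g (\<tau> * t)"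
      by (simp only: mult_ac)
    ultimately show ?thesis using DERIV_cmult[of _ _ _ UNIV \<sigma>] s2(3) by metis
  qed
  have "\<sigma> * b \<in> range (\<lambda>t. \<sigma> * f (\<tau> * t))"
  proof (rule increasing_reaches[OF d _ k', where a = "\<tau> * a"])
    show "0 \<le> \<bar>h\<bar> * g (\<tau> * t)" for t using g by simp
    show "\<sigma> * f (\<tau> * (\<tau> * a)) \<le> \<sigma> * b"
      using s2 by (simp add: \<sigma>_def flip: mult.assoc)
    show "\<bar>h\<bar> * k \<le> \<bar>h\<bar> * g (\<tau> * t)"
      if "\<sigma> * f (\<tau> * (\<tau> * a)) \<le> \<sigma> * f (\<tau> * t)" "\<sigma> * f (\<tau> * t) \<le> \<sigma> * b" for t
      using that s2(1) by (intro sp)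
        (auto simp: \<sigma>_def closed_segment_eq_real_ivl split: if_splits simp flip: mult.assoc)
  qed
  then obtain t where "\<sigma> * b = \<sigma> * f (\<tau> * t)" by auto
  then have "b = f (\<tau> * t)" by (auto simp: \<sigma>_def split: if_splits)
  then show ?thesis by blast
qed

section \<open>Polar angles and the arc on which the polar equation has positive radius\<close>

lemma polar_form:
  obtains \<rho> \<phi> :: real where "\<rho> \<ge> 0" "a = \<rho> * cos \<phi>" "b = \<rho> * sin \<phi>"
proof
  let ?z = "Complex a b"
  show "cmod ?z \<ge> 0" by simp
  show "a = cmod ?z * cos (Arg ?z)" "b = cmod ?z * sin (Arg ?z)"
    using rcis_cmod_Arg[of ?z] by (metis Re_rcis complex.sel(1), metis Im_rcis complex.sel(2))
qed

text \<open>With \<open>(e1, e2)\<close> of length \<rho> and angle \<phi>, the expression at \<psi>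
  is \<open>1 + \<rho> * cos (\<psi> - \<phi>)\<close>. Up to distance pi from \<phi> it can only
  decrease as \<psi> moves away, so positivity at two angles passes to all angles between them once
  both are measured from the same copy of \<phi>.\<close>

lemma arc_of_positivity:
  fixes e1 e2 \<alpha> \<beta> :: real
  assumes "1 + (e1 * cos \<alpha> + e2 * sin \<alpha>) > 0" and "1 + (e1 * cos \<beta> + e2 * sin \<beta>) > 0"
  obtains \<beta>' where "cos \<beta>' = cos \<beta>" "sin \<beta>' = sin \<beta>"
    "\<And>\<psi>. \<psi> \<in> closed_segment \<alpha> \<beta>' \<Longrightarrow> 1 + (e1 * cos \<psi> + e2 * sin \<psi>) > 0"
proof -
  obtain \<rho> \<phi> where \<rho>: "\<rho> \<ge> 0" and e: "e1 = \<rho> * cos \<phi>" "e2 = \<rho> * sin \<phi>"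
    by (rule polar_form)
  obtain y where y: "- pi < y" "y \<le> pi" "sin y = sin (\<alpha> - \<phi>)" "cos y = cos (\<alpha> - \<phi>)"
    using sincos_principal_value by blast
  obtain z where z: "- pi < z" "z \<le> pi" "sin z = sin (\<beta> - \<phi>)" "cos z = cos (\<beta> - \<phi>)"
    using sincos_principal_value by blast
  \<comment> \<open>Up to full turns, \<open>\<alpha> - y\<close> is \<phi>, at distance at most pi
    from \<alpha>; \<beta>' is the copy of \<beta> at offset \<open>z\<close> from this same
    copy.\<close>
  define \<beta>' where "\<beta>' = \<alpha> - y + z"
  have ephi: "e1 * cos \<psi> + e2 * sin \<psi> = \<rho> * cos (\<psi> - \<phi>)" for \<psi>
    by (simp add: e cos_diff algebra_simps)
  have ay: "cos (\<alpha> - y) = cos \<phi>" "sin (\<alpha> - y) = sin \<phi>"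
    using cos_diff[of \<alpha> "\<alpha> - \<phi>"] sin_diff[of \<alpha> "\<alpha> - \<phi>"]
    by (simp_all add: cos_diff[of \<alpha> y] sin_diff[of \<alpha> y] y)
  have cs: "cos (\<alpha> - y + s) = cos (\<phi> + s)" "sin (\<alpha> - y + s) = sin (\<phi> + s)" for s
    using ay cos_add[of "\<alpha> - y" s] sin_add[of "\<alpha> - y" s] by (simp_all add: cos_add sin_add)
  have eq: "cos (\<psi> - \<phi>) = cos (\<psi> - (\<alpha> - y))" for \<psi>
    by (simp add: cos_diff[of \<psi> \<phi>] cos_diff[of \<psi> "\<alpha> - y"] ay)
  show ?thesis
  proof (rule that[of \<beta>'])
    show "cos \<beta>' = cos \<beta>" "sin \<beta>' = sin \<beta>"
      using cos_add[of \<phi> "\<beta> - \<phi>"] sin_add[of \<phi> "\<beta> - \<phi>"]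
      by (simp_all add: \<beta>'_def cs cos_add[of \<phi> z] sin_add[of \<phi> z] z)
    fix \<psi> assume "\<psi> \<in> closed_segment \<alpha> \<beta>'"
    then have m: "\<bar>\<psi> - (\<alpha> - y)\<bar> \<le> max \<bar>y\<bar> \<bar>z\<bar>"
      by (auto simp: closed_segment_eq_real_ivl \<beta>'_def split: if_splits)
    have "cos (max \<bar>y\<bar> \<bar>z\<bar>) \<le> cos \<bar>\<psi> - (\<alpha> - y)\<bar>"
      using m y(1,2) z(1,2) by (intro cos_monotone_0_pi_le) auto
    moreover have "cos (max \<bar>y\<bar> \<bar>z\<bar>) = cos y \<or> cos (max \<bar>y\<bar> \<bar>z\<bar>) = cos z"
      by (simp add: max_def)
    ultimately have "cos y \<le> cos (\<psi> - \<phi>) \<or> cos z \<le> cos (\<psi> - \<phi>)"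
      unfolding eq by auto
    then have "\<rho> * cos y \<le> \<rho> * cos (\<psi> - \<phi>) \<or> \<rho> * cos z \<le> \<rho> * cos (\<psi> - \<phi>)"
      using \<rho> mult_left_mono by blast
    then show "1 + (e1 * cos \<psi> + e2 * sin \<psi>) > 0"
      using assms unfolding ephi y(4)[symmetric] z(4)[symmetric] by linarith
  qed
qed

section \<open>Conics from their focal polar equation\<close>

lemma infdist_hyperplane:
  fixes a :: "'a::euclidean_space"
  assumes a: "norm a = 1"
  shows "infdist x {y. a \<bullet> y = b} = \<bar>b - a \<bullet> x\<bar>"
proof -
  have "a \<bullet> a = 1" using a by (simp add: norm_eq_1)
  \<comment> \<open>The foot of the perpendicular from \<open>x\<close>.\<close>
  let ?q = "x + (b - a \<bullet> x) *\<^sub>R a"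
  have q: "?q \<in> {y. a \<bullet> y = b}"
    using \<open>a \<bullet> a = 1\<close> by (simp add: inner_add_right)
  have "infdist x {y. a \<bullet> y = b} \<le> dist x ?q" using q by (rule infdist_le)
  also have "\<dots> = \<bar>b - a \<bullet> x\<bar>" by (simp add: dist_norm a)
  finally have "infdist x {y. a \<bullet> y = b} \<le> \<bar>b - a \<bullet> x\<bar>" .
  moreover have "\<bar>b - a \<bullet> x\<bar> \<le> infdist x {y. a \<bullet> y = b}"
  proof -
    have "{y. a \<bullet> y = b} \<noteq> {}" using q by blast
    then show ?thesis
    proof (subst infdist_notempty, simp, intro cINF_greatest)
      fix y assume "y \<in> {y. a \<bullet> y = b}"
      then have "\<bar>b - a \<bullet> x\<bar> = \<bar>a \<bullet> (y - x)\<bar>" by (simp add: inner_diff_right)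
      also have "\<dots> \<le> norm a * norm (y - x)" by (rule Cauchy_Schwarz_ineq2)
      finally show "\<bar>b - a \<bullet> x\<bar> \<le> dist x y" by (simp add: a dist_norm norm_minus_commute)
    qed
  qed
  ultimately show ?thesis by simp
qed

text \<open>Squares away the distance to a second focus \<open>G\<close>, leaving a condition that
  is polynomial in \<open>norm Z\<close> and linear in \<open>G \<bullet> Z\<close>.\<close>

lemma norm_diff_eq_iff:
  fixes Z G :: "'a::real_inner"
  assumes "b \<ge> 0"
  shows "norm (Z - G) = b \<longleftrightarrow> (norm Z)\<^sup>2 - 2 * (G \<bullet> Z) + (norm G)\<^sup>2 = b\<^sup>2"
proof -
  have "norm (Z - G) = b \<longleftrightarrow> (norm (Z - G))\<^sup>2 = b\<^sup>2"
    using assms by (simp add: power2_eq_iff_nonneg)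
  also have "(norm (Z - G))\<^sup>2 = (norm Z)\<^sup>2 - 2 * (G \<bullet> Z) + (norm G)\<^sup>2"
    by (simp add: power2_norm_eq_inner algebra_simps inner_commute)
  finally show ?thesis .
qed

text \<open>Here \<open>norm e\<close> is the eccentricity and \<open>p\<close> the semi-latus
  rectum. With the second focus placed on the line through \<open>F\<close> along \<open>e\<close>,
  squaring turns the two-focus condition into a multiple of
  \<open>norm Z + e \<bullet> Z - p\<close>, where \<open>Z = X - F\<close>. The last set in the
  conclusion accommodates the far branch of a hyperbola; it is empty if
  \<open>norm e \<le> 1\<close>.\<close>

lemma conic_section_polar_equation:
  fixes F e :: "real^2"
  assumes p: "p > 0"
  obtains K where "conic_section_with_focus F K"
    "{X. norm (X - F) + e \<bullet> (X - F) = p} \<subseteq> K"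
    "K \<subseteq> {X. norm (X - F) + e \<bullet> (X - F) = p} \<union> {X. norm (X - F) = e \<bullet> (X - F) - p}"
proof -
  have CS: "\<bar>e \<bullet> Z\<bar> \<le> norm e * norm Z" for Z by (rule Cauchy_Schwarz_ineq2)
  consider "norm e < 1" | "norm e = 1" | "norm e > 1" by linarith
  then show ?thesis
  proof cases
    case 1
    have e2: "1 - (norm e)\<^sup>2 > 0" using 1 by (simp add: power_less_one_iff)
    \<comment> \<open>The semi-major axis. Since \<open>e\<close> points to the pericenter, the
      second focus \<open>F + g\<close> lies on the opposite side.\<close>
    define a where "a = p / (1 - (norm e)\<^sup>2)"
    have a: "a > 0" "p = a * (1 - (norm e)\<^sup>2)" using p e2 by (simp_all add: a_def)
    define g where "g = - (2 * a) *\<^sub>R e"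
    have ng: "norm g = 2 * a * norm e" using a by (simp add: g_def)
    have iff: "norm Z + norm (Z - g) = 2 * a \<longleftrightarrow> norm Z + e \<bullet> Z = p" for Z
    proof -
      have sq: "norm (Z - g) = 2 * a - norm Z \<longleftrightarrow> norm Z + e \<bullet> Z = p" if "norm Z \<le> 2 * a"
      proof -
        have "(norm Z)\<^sup>2 - 2 * (g \<bullet> Z) + (norm g)\<^sup>2 - (2 * a - norm Z)\<^sup>2
            = 4 * a * (norm Z + e \<bullet> Z - p)"
          unfolding ng a(2) by (simp add: g_def power2_eq_square algebra_simps)
        moreover have "0 \<le> 2 * a - norm Z" using that by simp
        ultimately show ?thesis
          using norm_diff_eq_iff[of "2 * a - norm Z" Z g] a(1) by auto
      qed
      \<comment> \<open>Squaring needs \<open>2 * a - norm Z\<close> to be nonnegative. The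
        apocenter distance \<open>a * (1 + norm e)\<close> bounds \<open>norm Z\<close>.\<close>
      have bound: "norm Z \<le> 2 * a" if "norm Z + e \<bullet> Z = p"
      proof -
        have "(1 - norm e) * norm Z \<le> p"
          using that CS[of Z] by (simp add: algebra_simps)
        also have "p = (1 - norm e) * (a * (1 + norm e))"
          by (simp add: a(2) power2_eq_square algebra_simps)
        finally have "norm Z \<le> a * (1 + norm e)" using 1 by simp
        also have "\<dots> \<le> a * 2" using a(1) 1 by (intro mult_left_mono) auto
        finally show ?thesis by simp
      qed
      show ?thesis
        using sq bound norm_ge_zero[of "Z - g"] by smt
    qed
    have "ellipse_with_focus F {X. norm (X - F) + e \<bullet> (X - F) = p}"
      unfolding ellipse_with_focus_def
    proof (intro exI conjI)
      show "dist F (F + g) < 2 * a" using a(1) 1 by (simp add: dist_norm ng)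
      show "{X. norm (X - F) + e \<bullet> (X - F) = p} = {X. dist X F + dist X (F + g) = 2 * a}"
        by (simp add: dist_norm diff_diff_add[symmetric] iff)
    qed
    then show ?thesis by (intro that) (auto simp: conic_section_with_focus_def)
  next
    case 2
    \<comment> \<open>The directrix.\<close>
    define L where "L = {X. e \<bullet> X = p + e \<bullet> F}"
    have inf: "infdist X L = \<bar>p - e \<bullet> (X - F)\<bar>" for X
      using 2 by (simp add: L_def infdist_hyperplane inner_diff_right algebra_simps)
    have "parabola_with_focus F {X. dist X F = infdist X L}"
      unfolding parabola_with_focus_def
    proof (intro exI conjI)
      show "affine L" by (simp add: L_def affine_hyperplane)
      show "aff_dim L = 1" using 2 by (subst L_def, subst aff_dim_hyperplane) auto
      show "F \<notin> L" using p by (simp add: L_def)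
    qed simp
    then show ?thesis
      by (intro that) (auto simp: conic_section_with_focus_def inf dist_norm)
  next
    case 3
    have e2: "(norm e)\<^sup>2 - 1 > 0" using 3 by (simp add: one_less_power)
    \<comment> \<open>Half the distance between the vertices. The second focus now lies in the
      direction of \<open>e\<close>, beyond the pericenter, so the branch near \<open>F\<close> is
      the one farther from \<open>F + g\<close>.\<close>
    define a where "a = p / ((norm e)\<^sup>2 - 1)"
    have a: "a > 0" "p = a * ((norm e)\<^sup>2 - 1)" using p e2 by (simp_all add: a_def)
    define g where "g = (2 * a) *\<^sub>R e"
    have ng: "norm g = 2 * a * norm e" using a by (simp add: g_def)
    have near: "norm (Z - g) = norm Z + 2 * a \<longleftrightarrow> norm Z + e \<bullet> Z = p" for Z
    proof -
      have "(norm Z)\<^sup>2 - 2 * (g \<bullet> Z) + (norm g)\<^sup>2 - (norm Z + 2 * a)\<^sup>2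
          = - (4 * a * (norm Z + e \<bullet> Z - p))"
        unfolding ng a(2) by (simp add: g_def power2_eq_square algebra_simps)
      moreover have "0 \<le> norm Z + 2 * a" using a(1) by simp
      ultimately show ?thesis
        using norm_diff_eq_iff[of "norm Z + 2 * a" Z g] a(1) by auto
    qed
    have far: "norm Z = e \<bullet> Z - p" if "norm (Z - g) = norm Z - 2 * a" for Z
    proof -
      have "(norm Z)\<^sup>2 - 2 * (g \<bullet> Z) + (norm g)\<^sup>2 = (norm Z - 2 * a)\<^sup>2"
        using that norm_ge_zero[of "Z - g"] norm_diff_eq_iff by metis
      then have "4 * a * norm Z = 4 * a * (e \<bullet> Z - p)"
        unfolding ng a(2) by (simp add: g_def power2_eq_square algebra_simps)
      then show ?thesis using a(1) by simp
    qed
    let ?K = "{X. \<bar>dist X F - dist X (F + g)\<bar> = 2 * a}"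
    have "hyperbola_with_focus F ?K"
      unfolding hyperbola_with_focus_def
    proof (intro exI conjI)
      show "2 * a < dist F (F + g)" using a(1) 3 by (simp add: dist_norm ng)
    qed (use a in auto)
    moreover have "{X. norm (X - F) + e \<bullet> (X - F) = p} \<subseteq> ?K"
    proof
      fix X assume "X \<in> {X. norm (X - F) + e \<bullet> (X - F) = p}"
      then have "norm (X - F - g) = norm (X - F) + 2 * a" by (simp add: near)
      then show "X \<in> ?K" using a(1) by (simp add: dist_norm diff_diff_add[symmetric])
    qed
    moreover have "?K \<subseteq> {X. norm (X - F) + e \<bullet> (X - F) = p} \<union> {X. norm (X - F) = e \<bullet> (X - F) - p}"
    proof
      fix X assume "X \<in> ?K"
      then have "norm (X - F - g) = norm (X - F) + 2 * a \<or> norm (X - F - g) = norm (X - F) - 2 * a"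
        by (auto simp: dist_norm diff_diff_add[symmetric])
      then show "X \<in> {X. norm (X - F) + e \<bullet> (X - F) = p} \<union> {X. norm (X - F) = e \<bullet> (X - F) - p}"
        using near far by blast
    qed
    ultimately show ?thesis by (intro that) (auto simp: conic_section_with_focus_def)
  qed
qed

section \<open>Components of the conic and surjectivity onto one of them\<close>

text \<open>A connected set between \<open>B\<close> and \<open>K\<close> is covered by the disjoint
  closed sets \<open>B\<close> and \<open>B'\<close>, so it lies in one of them; it contains the
  nonempty \<open>B\<close>, hence lies in \<open>B\<close>.\<close>

lemma in_components_if_closed_separated:
  assumes "connected B" "B \<noteq> {}" "closed B" "closed B'" "B \<inter> B' = {}" "B \<subseteq> K" "K \<subseteq> B \<union> B'"
  shows "B \<in> components K"
  unfolding in_components_maximal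
proof (intro conjI allI impI)
  fix D assume D: "D \<noteq> {} \<and> B \<subseteq> D \<and> D \<subseteq> K \<and> connected D"
  then have "B \<inter> D = {} \<or> B' \<inter> D = {}"
    using assms by (intro connected_closedD[of D B B']) auto
  then show "D = B" using assms D by blast
qed (use assms in auto)

lemma complete_motion_covers_orbit:
  fixes r \<theta> :: "real \<Rightarrow> real"
  assumes "h \<noteq> 0" and p: "p > 0" and r: "\<And>t. r t > 0"
    and d\<theta>: "\<And>t. (\<theta> has_real_derivative h / (r t)\<^sup>2) (at t)"
    and orbit: "\<And>t. r t * (1 + (e1 * cos (\<theta> t) + e2 * sin (\<theta> t))) = p"
    and \<rho>: "\<rho> > 0" "\<rho> * (1 + (e1 * cos \<phi> + e2 * sin \<phi>)) = p"
  obtains t where "r t = \<rho>" "cos (\<theta> t) = cos \<phi>" "sin (\<theta> t) = sin \<phi>"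
proof -
  define q where "q \<psi> = 1 + (e1 * cos \<psi> + e2 * sin \<psi>)" for \<psi>
  have rq: "r t * q (\<theta> t) = p" for t using orbit by (simp add: q_def)
  have qpos: "q (\<theta> t) > 0" for t
    using rq[of t] r[of t] p by (metis zero_less_mult_pos)
  have q\<phi>: "q \<phi> > 0" using \<rho> p by (metis q_def zero_less_mult_pos)
  obtain \<phi>' where \<phi>': "cos \<phi>' = cos \<phi>" "sin \<phi>' = sin \<phi>"
    and seg: "\<And>\<psi>. \<psi> \<in> closed_segment (\<theta> 0) \<phi>' \<Longrightarrow> q \<psi> > 0"
    using arc_of_positivity[of e1 "\<theta> 0" e2 \<phi>] qpos[of 0] q\<phi> unfolding q_def by blast
  have "continuous_on (closed_segment (\<theta> 0) \<phi>') q"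
    unfolding q_def by (intro continuous_intros)
  then obtain \<psi>0 where \<psi>0: "\<psi>0 \<in> closed_segment (\<theta> 0) \<phi>'"
    and min: "\<And>\<psi>. \<psi> \<in> closed_segment (\<theta> 0) \<phi>' \<Longrightarrow> q \<psi>0 \<le> q \<psi>"
    using continuous_attains_inf[of "closed_segment (\<theta> 0) \<phi>'" q] by auto
  have m: "q \<psi>0 > 0" using seg \<psi>0 .
  have "\<phi>' \<in> range \<theta>"
  proof (rule monotone_reaches[where a = 0 and g = "\<lambda>t. 1 / (r t)\<^sup>2" and h = h])
    show "(\<theta> has_real_derivative h * (1 / (r t)\<^sup>2)) (at t)" for t using d\<theta> by simp
    \<comment> \<open>On the compact arc the polar equation gives \<open>r = p / q\<close>, which is
      at most \<open>p / q \<psi>0\<close>; this bounds the angular speed from below.\<close>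
    show "0 < (q \<psi>0 / p)\<^sup>2" using m p by simp
    show "(q \<psi>0 / p)\<^sup>2 \<le> 1 / (r t)\<^sup>2" if "\<theta> t \<in> closed_segment (\<theta> 0) \<phi>'" for t
    proof -
      have "q \<psi>0 / p \<le> q (\<theta> t) / p" using min[OF that] p by (simp add: divide_right_mono)
      also have "\<dots> = 1 / r t" using rq[of t] r[of t] p by (simp add: field_simps)
      finally have "(q \<psi>0 / p)\<^sup>2 \<le> (1 / r t)\<^sup>2" using m p by (intro power_mono) auto
      then show ?thesis by (simp add: power_one_over)
    qed
  qed (use \<open>h \<noteq> 0\<close> in auto)
  then obtain t where t: "\<theta> t = \<phi>'" by auto
  \<comment> \<open>Reaching the angle suffices, as the polar equation then determines the
    radius.\<close>
  have "q \<phi>' = q \<phi>" by (simp add: q_def \<phi>')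
  then have "r t * q \<phi> = \<rho> * q \<phi>" using rq[of t] \<rho>(2) by (simp add: t q_def)
  then have "r t = \<rho>" using q\<phi> by simp
  then show ?thesis by (rule that) (simp_all add: t \<phi>')
qed

section \<open>The motion as a curve in the plane\<close>

lemma norm_cos_sin_vector [simp]: "norm (vector [cos \<phi>, sin \<phi>] :: real^2) = 1"
  by (simp add: norm_eq_1 inner_vec_def sum_2 flip: power2_eq_square)

lemma polar_form_vector:
  fixes Z :: "real^2"
  obtains \<rho> \<phi> where "\<rho> \<ge> 0" "Z = \<rho> *\<^sub>R vector [cos \<phi>, sin \<phi>]"
proof -
  obtain \<rho> \<phi> where "\<rho> \<ge> 0" "Z $ 1 = \<rho> * cos \<phi>" "Z $ 2 = \<rho> * sin \<phi>"
    by (rule polar_form)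
  then show ?thesis by (intro that[of \<rho> \<phi>]) (simp_all add: vec_eq_iff forall_2)
qed

lemma has_real_derivative_vec_nth:
  fixes f :: "real \<Rightarrow> real^'n"
  assumes "(f has_vector_derivative f') (at t)"
  shows "((\<lambda>t. f t $ i) has_real_derivative f' $ i) (at t)"
  using bounded_linear.has_vector_derivative[OF bounded_linear_vec_nth assms]
  by (simp add: has_real_derivative_iff_has_vector_derivative)

text \<open>A motion on a smaller time interval may trace only part of a conic, and with zero areal
  velocity it stays on a ray from the center; the whole orbit is therefore identified for
  \<open>T = UNIV\<close>. It is a component of \<open>K\<close> rather than \<open>K\<close> itself
  because a hyperbola has two branches, of which the motion follows one.\<close>

theorem theorem6p1:
  fixes Oc :: "real^2" and P v :: "real \<Rightarrow> real^2"
    and r \<theta> :: "real \<Rightarrow> real" and C :: real and T :: "real set"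
  assumes "open T" and "is_interval T"
    and "C > 0"
    and "\<And>t. t \<in> T \<Longrightarrow> r t > 0"
    and "\<And>t. t \<in> T \<Longrightarrow> P t = Oc + r t *\<^sub>R vector [cos (\<theta> t), sin (\<theta> t)]"
    and "\<And>t. t \<in> T \<Longrightarrow> \<theta> differentiable (at t)"
    and "\<And>t. t \<in> T \<Longrightarrow> (P has_vector_derivative v t) (at t)"
    and "\<And>t. t \<in> T \<Longrightarrow>
      (v has_vector_derivative (C / (r t)\<^sup>2) *\<^sub>R vector [- cos (\<theta> t), - sin (\<theta> t)]) (at t)"
  shows "\<exists>c. (\<forall>t\<in>T. areal_velocity r \<theta> t = c) \<and>
    (T = UNIV \<longrightarrow> (\<exists>K. conic_section_with_focus Oc K \<and> P ` T \<in> components K)) \<and>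
    (c \<noteq> 0 \<longrightarrow> (\<exists>K. conic_section_with_focus Oc K \<and> P ` T \<subseteq> K)) \<and>
    (c = 0 \<longrightarrow> (\<exists>u. norm u = 1 \<and> P ` T \<subseteq> {Oc + s *\<^sub>R u |s. s > 0}))"
proof -
  note r = assms(4) and P = assms(5) and dP = assms(7)
  define U :: "real \<Rightarrow> real^2" where "U \<phi> = vector [cos \<phi>, sin \<phi>]" for \<phi>
  have normU: "norm (U \<phi>) = 1" for \<phi> by (simp add: U_def)
  have PU: "P t - Oc = r t *\<^sub>R U (\<theta> t)" if "t \<in> T" for t
    using P[OF that] by (simp add: U_def)
  have "convex T" using \<open>is_interval T\<close> by (simp add: is_interval_convex_1)
  have dv: "((\<lambda>t. v t $ 1) has_real_derivative - (C / (r t)\<^sup>2 * cos (\<theta> t))) (at t)"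
    "((\<lambda>t. v t $ 2) has_real_derivative - (C / (r t)\<^sup>2 * sin (\<theta> t))) (at t)" if "t \<in> T" for t
    using has_real_derivative_vec_nth[OF assms(8)[OF that], of 1]
      has_real_derivative_vec_nth[OF assms(8)[OF that], of 2] by simp_all
  have dP': "((\<lambda>t. P t $ i - Oc $ i) has_real_derivative v t $ i) (at t)" if "t \<in> T" for t i
    using has_real_derivative_vec_nth[OF dP[OF that]] by (auto intro!: derivative_eq_intros)
  obtain h e1 e2 where
    d\<theta>: "\<And>t. t \<in> T \<Longrightarrow> (\<theta> has_real_derivative h / (r t)\<^sup>2) (at t)" and
    orbit: "\<And>t. t \<in> T \<Longrightarrow> r t * (1 + (e1 * cos (\<theta> t) + e2 * sin (\<theta> t))) = h\<^sup>2 / C"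
    by (rule areal_integral_and_polar_equation[where x = "\<lambda>t. P t $ 1 - Oc $ 1"
          and y = "\<lambda>t. P t $ 2 - Oc $ 2" and v = "\<lambda>t. v t $ 1" and w = "\<lambda>t. v t $ 2"
          and r = r and \<theta> = \<theta> and T = T and C = C])
      (use \<open>convex T\<close> \<open>C > 0\<close> \<open>open T\<close> r assms(6) dv dP' in \<open>auto simp: P\<close>)
  define e :: "real^2" where "e = vector [e1, e2]"
  have eU: "e \<bullet> U \<phi> = e1 * cos \<phi> + e2 * sin \<phi>" for \<phi>
    by (simp add: e_def U_def inner_vec_def sum_2)
  define p where "p = h\<^sup>2 / C"
  define B where "B = {X. norm (X - Oc) + e \<bullet> (X - Oc) = p}"
  have area: "areal_velocity r \<theta> t = h / 2" if "t \<in> T" for t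
    using DERIV_imp_deriv[OF d\<theta>[OF that]] r[OF that] by (simp add: areal_velocity_def)
  have onB: "P ` T \<subseteq> B"
  proof
    fix X assume "X \<in> P ` T"
    then obtain t where t: "t \<in> T" "X = P t" by blast
    have "norm (X - Oc) + e \<bullet> (X - Oc) = r t * (1 + e \<bullet> U (\<theta> t))"
      using r[OF t(1)] by (simp add: t PU normU algebra_simps)
    then show "X \<in> B" using orbit[OF t(1)] by (simp add: B_def eU p_def)
  qed
  have \<theta>const: "\<theta> t = \<theta> s" if "h = 0" "t \<in> T" "s \<in> T" for s t
  proof -
    have "\<exists>c. \<forall>t\<in>T. \<theta> t = c"
      using has_field_derivative_zero_constant[OF \<open>convex T\<close>, of \<theta>] d\<theta> \<open>h = 0\<close>
      by (metis div_0 has_field_derivative_at_within)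
    then show ?thesis using that by auto
  qed
  have line: "\<exists>u. norm u = 1 \<and> P ` T \<subseteq> {Oc + s *\<^sub>R u |s. s > 0}" if "h = 0"
  proof (cases "T = {}")
    case True
    then show ?thesis using normU by auto
  next
    case False
    then obtain t0 where t0: "t0 \<in> T" by blast
    have "P t = Oc + r t *\<^sub>R U (\<theta> t0)" if "t \<in> T" for t
      using P[OF that] \<theta>const[OF \<open>h = 0\<close> that t0] by (simp add: U_def)
    then show ?thesis using normU r by blast
  qed
  have "h \<noteq> 0" if T: "T = UNIV"
  proof
    assume "h = 0"
    define \<phi> where "\<phi> = \<theta> 0"
    have \<theta>: "\<theta> t = \<phi>" for t using \<theta>const[OF \<open>h = 0\<close>] T by (simp add: \<phi>_def)
    \<comment> \<open>On a fixed ray, \<open>r\<close> is the projection of the position onto the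
      direction of the ray. It thus inherits two derivatives from \<open>P\<close>, the second being
      -C / r^2 < 0.\<close>
    have rt: "(\<lambda>t. cos \<phi> * (P t $ 1 - Oc $ 1) + sin \<phi> * (P t $ 2 - Oc $ 2)) = r"
    proof
      fix t
      have "P t $ 1 - Oc $ 1 = r t * cos \<phi>" "P t $ 2 - Oc $ 2 = r t * sin \<phi>"
        using P[of t] T \<theta> by simp_all
      then have "cos \<phi> * (P t $ 1 - Oc $ 1) + sin \<phi> * (P t $ 2 - Oc $ 2)
          = r t * ((cos \<phi>)\<^sup>2 + (sin \<phi>)\<^sup>2)"
        by algebra
      then show "cos \<phi> * (P t $ 1 - Oc $ 1) + sin \<phi> * (P t $ 2 - Oc $ 2) = r t" by simp
    qed
    show False
    proof (rule not_strictly_concave_positive[of r "\<lambda>t. cos \<phi> * v t $ 1 + sin \<phi> * v t $ 2"])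
      fix t
      have t: "t \<in> T" using T by simp
      show "r t > 0" using r[OF t] .
      show "(r has_real_derivative cos \<phi> * v t $ 1 + sin \<phi> * v t $ 2) (at t)"
        using DERIV_add[OF DERIV_cmult[OF dP'[OF t, of 1], of "cos \<phi>"]
            DERIV_cmult[OF dP'[OF t, of 2], of "sin \<phi>"]] unfolding rt .
      have "- (C / (r t)\<^sup>2) = - (C / (r t)\<^sup>2) * ((cos \<phi>)\<^sup>2 + (sin \<phi>)\<^sup>2)" by simp
      also have "\<dots> = cos \<phi> * - (C / (r t)\<^sup>2 * cos (\<theta> t)) + sin \<phi> * - (C / (r t)\<^sup>2 * sin (\<theta> t))"
        unfolding \<theta> power2_eq_square[of "cos \<phi>"] power2_eq_square[of "sin \<phi>"]
        by (simp only: distrib_left) (simp only: mult_minus_left mult_minus_right mult_ac)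
      finally have "((\<lambda>t. cos \<phi> * v t $ 1 + sin \<phi> * v t $ 2) has_real_derivative - (C / (r t)\<^sup>2)) (at t)"
        using DERIV_add[OF DERIV_cmult[OF dv(1)[OF t], of "cos \<phi>"]
            DERIV_cmult[OF dv(2)[OF t], of "sin \<phi>"]] by simp
      moreover have "- (C / (r t)\<^sup>2) < 0" using \<open>C > 0\<close> r[OF t] by simp
      ultimately show "\<exists>d<0. ((\<lambda>t. cos \<phi> * v t $ 1 + sin \<phi> * v t $ 2) has_real_derivative d) (at t)"
        by blast
    qed
  qed
  moreover have "\<exists>K. conic_section_with_focus Oc K \<and> P ` T \<subseteq> K \<and> (T = UNIV \<longrightarrow> P ` T \<in> components K)"
    if "h \<noteq> 0"
  proof -
    have p: "p > 0" using that \<open>C > 0\<close> by (simp add: p_def)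
    let ?B' = "{X. norm (X - Oc) = e \<bullet> (X - Oc) - p}"
    obtain K where K: "conic_section_with_focus Oc K" "B \<subseteq> K" "K \<subseteq> B \<union> ?B'"
      unfolding B_def by (rule conic_section_polar_equation[OF p])
    have "P ` T \<in> components K" if T: "T = UNIV"
    proof -
      have "B \<subseteq> P ` T"
      proof
        fix X assume X: "X \<in> B"
        obtain \<rho> \<phi> where \<rho>: "\<rho> \<ge> 0" "X - Oc = \<rho> *\<^sub>R U \<phi>"
          unfolding U_def by (rule polar_form_vector)
        have eq: "\<rho> * (1 + (e1 * cos \<phi> + e2 * sin \<phi>)) = p"
          using X \<rho> by (simp add: B_def normU eU algebra_simps)
        then have "\<rho> > 0" using \<rho>(1) p by (cases "\<rho> = 0") auto
        obtain t where "r t = \<rho>" "cos (\<theta> t) = cos \<phi>" "sin (\<theta> t) = sin \<phi>"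
          using complete_motion_covers_orbit[OF \<open>h \<noteq> 0\<close> p _ _ _ \<open>\<rho> > 0\<close> eq, of r \<theta>]
            r d\<theta> orbit by (auto simp: T p_def)
        then have "P t - Oc = X - Oc" using PU[of t] T \<rho>(2) by (simp add: U_def)
        then show "X \<in> P ` T" using T by auto
      qed
      then have PB: "P ` T = B" using onB by blast
      have "continuous_on T P"
        using dP by (meson continuous_at_imp_continuous_on has_vector_derivative_continuous)
      then have "connected B"
        using \<open>convex T\<close> PB connected_continuous_image convex_connected by metis
      moreover have "B \<noteq> {}" using PB T by auto
      moreover have "closed B" "closed ?B'"
        unfolding B_def by (intro closed_Collect_eq continuous_intros)+
      moreover have "B \<inter> ?B' = {}"
      proof -
        \<comment> \<open>The two equations add up to \<open>norm Z = 0\<close>, which forces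
          \<open>p = 0\<close>.\<close>
        have False if "norm Z + e \<bullet> Z = p" "norm Z = e \<bullet> Z - p" for Z
        proof -
          have "norm Z = 0" using that by linarith
          then show False using that p by simp
        qed
        then show ?thesis by (auto simp: B_def)
      qed
      ultimately show ?thesis
        unfolding PB using K(2,3) by (rule in_components_if_closed_separated)
    qed
    then show ?thesis using K onB by blast
  qed
  ultimately show ?thesis
    using area line by (intro exI[of _ "h / 2"]) auto
qed

end
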